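(* Let $a_1,a_2,b_1,b_2,\gamma_1,\gamma_2,\gamma_3\in\mathbb{C}$ with $c=a_1b_2-a_2b_1\ne0$, let $c_{n\ell}$ ($n=1,2$; $\ell=1,2,3,4$) be the coefficients determined by these parameters as in the context, let $u_1,u_2,u_3$ be the roots, assumed pairwise distinct, of $u^3+\gamma_1u^2+(\gamma_2-1)u+\gamma_3$, and let $\lambda_j=\Big[\prod_{\ell\neq j}(u_j-u_\ell)\Big]^{-1}$, $j=1,2,3$. Suppose that $\lambda_1,\lambda_2,\lambda_3$ are rational numbers. Let $(x_1(t),x_2(t))$ be a solution, on an open interval of $\mathbb{R}$ containing $0$ or on a connected and simply connected open subset of $\mathbb{C}$ containing $0$, of $$\dot x_n=c_{n1}x_1^3+c_{n2}x_1^2x_2+c_{n3}x_1x_2^2+c_{n4}x_2^3,\qquad n=1,2,$$ such that $y(0)\neq0$ and $w(0)/y(0)\notin\{u_1,u_2,u_3\}$, where $y=a_1x_1+a_2x_2$ and $w=b_1x_1+b_2x_2$. Then $u(t)=w(t)/y(t)$ is an algebraic function of $t$, and $x_1(t)$ and $x_2(t)$ are algebraic functions of $t$.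
   Context: A function $f(t)$ is algebraic if there is a nonzero polynomial $P\in\mathbb{C}[T,X]$ with $P(t,f(t))=0$ for all $t$ in its domain. The coefficients $c_{n\ell}$ are defined by $$c_{11}=\frac{a_1^3b_2-a_2K_1}{c},\quad c_{21}=\frac{-a_1^3b_1+a_1K_1}{c},\quad c_{12}=\frac{3a_1^2a_2b_2-a_2K_2}{c},\quad c_{22}=\frac{-3a_1^2a_2b_1+a_1K_2}{c},$$ $$c_{13}=\frac{3a_1a_2^2b_2-a_2K_3}{c},\quad c_{23}=\frac{-3a_1a_2^2b_1+a_1K_3}{c},\quad c_{14}=\frac{a_2^3b_2-a_2K_4}{c},\quad c_{24}=\frac{-a_2^3b_1+a_1K_4}{c},$$ with $$K_1=\gamma_1a_1b_1^2+\gamma_2a_1^2b_1+\gamma_3a_1^3+b_1^3,$$ $$K_2=\gamma_1(a_2b_1^2+2a_1b_1b_2)+\gamma_2(a_1^2b_2+2a_1a_2b_1)+3\gamma_3a_1^2a_2+3b_1^2b_2,$$ $$K_3=\gamma_1(a_1b_2^2+2a_2b_1b_2)+\gamma_2(a_2^2b_1+2a_1a_2b_2)+3\gamma_3a_1a_2^2+3b_1b_2^2,$$ $$K_4=\gamma_1a_2b_2^2+\gamma_2a_2^2b_2+\gamma_3a_2^3+b_2^3.$$ Equivalently, the system is $\dot y=y^3$, $\dot w=w^3+\gamma_1yw^2+\gamma_2y^2w+\gamma_3y^3$ in the variables $y=a_1x_1+a_2x_2$, $w=b_1x_1+b_2x_2$. *)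

theory Defs
  imports "HOL-Analysis.Analysis" "HOL-Computational_Algebra.Polynomial"
begin

text \<open>
  The families \<open>a\<close>, \<open>b\<close>, \<open>\<gamma>\<close>, \<open>u\<close> are functions on \<^typ>\<open>nat\<close> that are only used
  at the indices occurring in the mathematics, \<open>1, 2\<close> or \<open>1, 2, 3\<close>.
\<close>

definition cdet :: "(nat \<Rightarrow> complex) \<Rightarrow> (nat \<Rightarrow> complex) \<Rightarrow> complex" where
  "cdet a b = a 1 * b 2 - a 2 * b 1"

definition K1 :: "(nat \<Rightarrow> complex) \<Rightarrow> (nat \<Rightarrow> complex) \<Rightarrow> (nat \<Rightarrow> complex) \<Rightarrow> complex" where
  "K1 a b \<gamma> = \<gamma> 1 * a 1 * b 1 ^ 2 + \<gamma> 2 * a 1 ^ 2 * b 1 + \<gamma> 3 * a 1 ^ 3 + b 1 ^ 3"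

definition K2 :: "(nat \<Rightarrow> complex) \<Rightarrow> (nat \<Rightarrow> complex) \<Rightarrow> (nat \<Rightarrow> complex) \<Rightarrow> complex" where
  "K2 a b \<gamma> = \<gamma> 1 * (a 2 * b 1 ^ 2 + 2 * a 1 * b 1 * b 2)
     + \<gamma> 2 * (a 1 ^ 2 * b 2 + 2 * a 1 * a 2 * b 1)
     + 3 * \<gamma> 3 * a 1 ^ 2 * a 2 + 3 * b 1 ^ 2 * b 2"

definition K3 :: "(nat \<Rightarrow> complex) \<Rightarrow> (nat \<Rightarrow> complex) \<Rightarrow> (nat \<Rightarrow> complex) \<Rightarrow> complex" where
  "K3 a b \<gamma> = \<gamma> 1 * (a 1 * b 2 ^ 2 + 2 * a 2 * b 1 * b 2)
     + \<gamma> 2 * (a 2 ^ 2 * b 1 + 2 * a 1 * a 2 * b 2)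
     + 3 * \<gamma> 3 * a 1 * a 2 ^ 2 + 3 * b 1 * b 2 ^ 2"

definition K4 :: "(nat \<Rightarrow> complex) \<Rightarrow> (nat \<Rightarrow> complex) \<Rightarrow> (nat \<Rightarrow> complex) \<Rightarrow> complex" where
  "K4 a b \<gamma> = \<gamma> 1 * a 2 * b 2 ^ 2 + \<gamma> 2 * a 2 ^ 2 * b 2 + \<gamma> 3 * a 2 ^ 3 + b 2 ^ 3"

definition c11 :: "(nat \<Rightarrow> complex) \<Rightarrow> (nat \<Rightarrow> complex) \<Rightarrow> (nat \<Rightarrow> complex) \<Rightarrow> complex" where
  "c11 a b \<gamma> = (a 1 ^ 3 * b 2 - a 2 * K1 a b \<gamma>) / cdet a b"

definition c21 :: "(nat \<Rightarrow> complex) \<Rightarrow> (nat \<Rightarrow> complex) \<Rightarrow> (nat \<Rightarrow> complex) \<Rightarrow> complex" where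
  "c21 a b \<gamma> = (- (a 1 ^ 3 * b 1) + a 1 * K1 a b \<gamma>) / cdet a b"

definition c12 :: "(nat \<Rightarrow> complex) \<Rightarrow> (nat \<Rightarrow> complex) \<Rightarrow> (nat \<Rightarrow> complex) \<Rightarrow> complex" where
  "c12 a b \<gamma> = (3 * a 1 ^ 2 * a 2 * b 2 - a 2 * K2 a b \<gamma>) / cdet a b"

definition c22 :: "(nat \<Rightarrow> complex) \<Rightarrow> (nat \<Rightarrow> complex) \<Rightarrow> (nat \<Rightarrow> complex) \<Rightarrow> complex" where
  "c22 a b \<gamma> = (- (3 * a 1 ^ 2 * a 2 * b 1) + a 1 * K2 a b \<gamma>) / cdet a b"

definition c13 :: "(nat \<Rightarrow> complex) \<Rightarrow> (nat \<Rightarrow> complex) \<Rightarrow> (nat \<Rightarrow> complex) \<Rightarrow> complex" where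
  "c13 a b \<gamma> = (3 * a 1 * a 2 ^ 2 * b 2 - a 2 * K3 a b \<gamma>) / cdet a b"

definition c23 :: "(nat \<Rightarrow> complex) \<Rightarrow> (nat \<Rightarrow> complex) \<Rightarrow> (nat \<Rightarrow> complex) \<Rightarrow> complex" where
  "c23 a b \<gamma> = (- (3 * a 1 * a 2 ^ 2 * b 1) + a 1 * K3 a b \<gamma>) / cdet a b"

definition c14 :: "(nat \<Rightarrow> complex) \<Rightarrow> (nat \<Rightarrow> complex) \<Rightarrow> (nat \<Rightarrow> complex) \<Rightarrow> complex" where
  "c14 a b \<gamma> = (a 2 ^ 3 * b 2 - a 2 * K4 a b \<gamma>) / cdet a b"

definition c24 :: "(nat \<Rightarrow> complex) \<Rightarrow> (nat \<Rightarrow> complex) \<Rightarrow> (nat \<Rightarrow> complex) \<Rightarrow> complex" where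
  "c24 a b \<gamma> = (- (a 2 ^ 3 * b 1) + a 1 * K4 a b \<gamma>) / cdet a b"

definition lam :: "(nat \<Rightarrow> complex) \<Rightarrow> nat \<Rightarrow> complex" where
  "lam u j = inverse (\<Prod>l\<in>{1, 2, 3} - {j}. u j - u l)"

text \<open>
  The two kinds of time domain. A real interval is regarded as a subset of \<open>\<complex>\<close>;
  for \<open>t\<close> in such a set \<open>D\<close>, the derivative of a complex-valued function at \<open>t\<close> within
  \<open>D\<close> is its ordinary derivative in the real variable, and for open \<open>D\<close> it is the
  complex derivative.
\<close>

definition real_time_domain :: "complex set \<Rightarrow> bool" where
  "real_time_domain D \<longleftrightarrow>
     (\<exists>I :: real set. open I \<and> is_interval I \<and> 0 \<in> I \<and> D = complex_of_real ` I)"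

definition complex_time_domain :: "complex set \<Rightarrow> bool" where
  "complex_time_domain D \<longleftrightarrow> open D \<and> connected D \<and> simply_connected D \<and> 0 \<in> D"

text \<open>
  \<open>\<complex>[T,X]\<close> is represented as \<open>\<complex>[T][X]\<close>: the coefficients are polynomials in \<open>T\<close>, so
  \<^term>\<open>poly (poly P [:z:]) t\<close> is the value of \<open>P\<close> at \<open>T = t\<close>, \<open>X = z\<close>.
\<close>

definition algebraic_function_on :: "complex set \<Rightarrow> (complex \<Rightarrow> complex) \<Rightarrow> bool" where
  "algebraic_function_on D f \<longleftrightarrow>
     (\<exists>P :: complex poly poly. P \<noteq> 0 \<and> (\<forall>t\<in>D. poly (poly P [:f t:]) t = 0))"

end

theory Submission
  imports Defs
begin

text \<open>
  In the variables \<open>y\<close>, \<open>w\<close> the system is \<open>y' = y^3\<close> together with a homogeneous cubic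
  equation for \<open>w\<close>, so that \<open>f = w / y\<close> satisfies \<open>f' = y^2 (f - u\<^sub>1) (f - u\<^sub>2) (f - u\<^sub>3)\<close>.
  Explicitly \<open>y^2 \<tau> = y(0)^2\<close> with \<open>\<tau>(t) = 1 - 2 y(0)^2 t\<close>, hence \<open>\<tau>'/\<tau> = - 2 y^2\<close>. Each
  \<open>f - u\<^sub>j\<close> has the logarithmic derivative \<open>y^2 (\<Prod>l\<noteq>j. f - u\<^sub>l)\<close>, and Lagrange interpolation of
  the constant \<open>1\<close> (\<open>lagrange_sum_eq_1\<close>) says that these add up to \<open>y^2\<close> when weighted with the
  \<open>\<lambda>\<^sub>j\<close>. So \<open>\<tau> (\<Prod>j. (f - u\<^sub>j) powr (2 \<lambda>\<^sub>j))\<close> is formally a constant of motion. If the \<open>\<lambda>\<^sub>j\<close> are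
  rational, clearing denominators and moving negative exponents to the other side turns this into
  a polynomial relation
  \<open>\<tau>^N (\<Prod>j. (f - u\<^sub>j)^(p j)) = C (\<Prod>j. (f - u\<^sub>j)^(m j))\<close>
  with \<open>C \<noteq> 0\<close>, which makes \<open>f\<close> algebraic (\<open>algebraic_function_on_first_integral\<close>).

  No logarithm or fractional power of a function is ever taken: two functions with the same
  logarithmic derivative are proportional on a connected, locally convex domain
  (\<open>log_deriv_on_unique\<close>), and this is proved by a local contraction estimate that treats
  real and complex time alike.

  Finally \<open>x\<^sub>1\<close> and \<open>x\<^sub>2\<close> are \<open>y\<close> times affine functions of \<open>f\<close>. Since \<open>y\<close> is the square root of a
  rational function, algebraicity of such products
  (\<open>algebraic_function_on_mult_sqrt\<close>) reduces to algebraicity of the square of an algebraic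
  function, for which an even-odd decomposition of polynomials replaces resultants.
\<close>

section \<open>Algebraic functions\<close>

lemma poly_poly_eval: "poly (poly P r) t = poly (poly P [:poly r t:]) t"
  for P :: "complex poly poly"
  by (induction P) auto

text \<open>Substituting a nonconstant polynomial for \<open>X\<close> cannot annihilate a nonzero annihilating polynomial.\<close>

lemma algebraic_function_onI:
  assumes "algebraic_function_on D f" "degree Q > 0"
    and "\<And>t. t \<in> D \<Longrightarrow> poly (poly Q [:g t:]) t = f t"
  shows "algebraic_function_on D g"
proof -
  obtain P where P: "P \<noteq> 0" "\<forall>t\<in>D. poly (poly P [:f t:]) t = 0"
    using assms(1) by (auto simp: algebraic_function_on_def)
  have "pcompose P Q \<noteq> 0"
    using P(1) assms(2) by (simp add: pcompose_eq_0_iff)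
  moreover have "poly (poly (pcompose P Q) [:g t:]) t = 0" if "t \<in> D" for t
    using P(2) assms(3)[OF that] that poly_poly_eval[of P "poly Q [:g t:]" t]
    by (simp add: poly_pcompose)
  ultimately show ?thesis by (auto simp: algebraic_function_on_def)
qed

lemma algebraic_function_on_const: "algebraic_function_on D (\<lambda>t. k)"
  unfolding algebraic_function_on_def by (rule exI[of _ "[:[:-k:], 1:]"]) simp

lemma algebraic_function_on_affine:
  assumes "algebraic_function_on D f"
  shows "algebraic_function_on D (\<lambda>t. \<alpha> + \<beta> * f t)"
proof (cases "\<beta> = 0")
  case True
  then show ?thesis using algebraic_function_on_const by simp
next
  case False
  show ?thesis
    by (rule algebraic_function_onI[OF assms, of "[:[:-\<alpha>/\<beta>:], [:1/\<beta>:]:]"])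
       (use False in \<open>auto simp: field_simps\<close>)
qed

lemma poly_even_odd_parts:
  obtains E O' :: "'a::comm_ring_1 poly"
  where "P = pcompose E [:0, 0, 1:] + [:0, 1:] * pcompose O' [:0, 0, 1:]"
proof -
  have "\<exists>E O'. P = pcompose E [:0, 0, 1:] + [:0, 1:] * pcompose O' [:0, 0, 1:]"
  proof (induction P)
    case 0
    then show ?case by (rule_tac exI[of _ 0])+ simp
  next
    case (pCons k P)
    then obtain E O' where "P = pcompose E [:0, 0, 1:] + [:0, 1:] * pcompose O' [:0, 0, 1:]"
      by blast
    then have "pCons k P = pcompose (pCons k O') [:0, 0, 1:] + [:0, 1:] * pcompose E [:0, 0, 1:]"
      by (simp add: pcompose_pCons algebra_simps)
    then show ?case by blast
  qed
  then show ?thesis using that by blast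
qed

text \<open>
  If \<open>P = E(X^2) + X O(X^2)\<close> annihilates \<open>f\<close>, then so does \<open>P(X) P(-X) = E(X^2)^2 - X^2 O(X^2)^2\<close>,
  which is a polynomial in \<open>X^2\<close>. As a polynomial in \<open>X^2\<close> it is nonzero because \<open>E^2\<close> has even
  and \<open>X O^2\<close> odd degree.
\<close>

lemma algebraic_function_on_square:
  assumes "algebraic_function_on D f"
  shows "algebraic_function_on D (\<lambda>t. f t ^ 2)"
proof -
  obtain P where P: "P \<noteq> 0" "\<forall>t\<in>D. poly (poly P [:f t:]) t = 0"
    using assms by (auto simp: algebraic_function_on_def)
  obtain E O' where EO: "P = pcompose E [:0, 0, 1:] + [:0, 1:] * pcompose O' [:0, 0, 1:]"
    by (rule poly_even_odd_parts)
  define R where "R = E ^ 2 - [:0, 1:] * O' ^ 2"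
  have "R \<noteq> 0"
  proof
    assume "R = 0"
    then have eq: "E ^ 2 = [:0, 1:] * O' ^ 2" by (simp add: R_def)
    have "O' = 0"
    proof (rule ccontr)
      assume "O' \<noteq> 0"
      then have "degree ([:0, 1:] * O' ^ 2) = Suc (2 * degree O')"
        by (subst degree_mult_eq) (auto simp: degree_power_eq)
      moreover have "even (degree (E ^ 2))"
        by (cases "E = 0") (auto simp: degree_power_eq)
      ultimately show False using eq by simp
    qed
    moreover from this have "E = 0" using eq by simp
    ultimately show False using EO P(1) by simp
  qed
  moreover have "poly (poly R [:f t ^ 2:]) t = 0" if "t \<in> D" for t
  proof -
    have "poly (poly P [:f t:]) t
        = poly (poly E [:f t ^ 2:]) t + f t * poly (poly O' [:f t ^ 2:]) t"
      unfolding EO by (simp add: poly_pcompose power2_eq_square)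
    then have "poly (poly E [:f t ^ 2:]) t = - (f t * poly (poly O' [:f t ^ 2:]) t)"
      using P(2) that by (simp add: eq_neg_iff_add_eq_0)
    then show ?thesis
      by (simp add: R_def power_mult_distrib)
  qed
  ultimately show ?thesis by (auto simp: algebraic_function_on_def)
qed

text \<open>
  With \<open>v = y f\<close> one has \<open>v^2 \<tau> / s = f^2\<close>, so an annihilating polynomial of \<open>f^2\<close> gives one of
  \<open>v\<close> by substitution.
\<close>

lemma algebraic_function_on_mult_sqrt:
  assumes "algebraic_function_on D f" "\<tau> \<noteq> 0" "s \<noteq> 0"
    and y: "\<And>t. t \<in> D \<Longrightarrow> y t ^ 2 * poly \<tau> t = s"
  shows "algebraic_function_on D (\<lambda>t. y t * f t)"
proof (rule algebraic_function_onI[OF algebraic_function_on_square[OF assms(1)]])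
  let ?Q = "[:0, 0, smult (1 / s) \<tau>:]"
  show "degree ?Q > 0" using assms by auto
  show "poly (poly ?Q [:y t * f t:]) t = f t ^ 2" if "t \<in> D" for t
  proof -
    have "poly (poly ?Q [:y t * f t:]) t = (y t ^ 2 * poly \<tau> t) * f t ^ 2 / s"
      by (simp add: power2_eq_square)
    then show ?thesis using y[OF that] \<open>s \<noteq> 0\<close> by simp
  qed
qed

section \<open>Functions with a prescribed logarithmic derivative\<close>

text \<open>
  Stating \<open>f'/f = \<phi>\<close> as \<open>f' = \<phi> f\<close> allows \<open>f\<close> to have zeros, so that nothing has to be known
  about the zeros of the functions below before the first integral is available.
\<close>

definition log_deriv_on ::
    "complex set \<Rightarrow> (complex \<Rightarrow> complex) \<Rightarrow> (complex \<Rightarrow> complex) \<Rightarrow> bool" where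
  "log_deriv_on D f \<phi> \<longleftrightarrow> (\<forall>t\<in>D. (f has_field_derivative \<phi> t * f t) (at t within D))"

lemma log_deriv_on_mult:
  assumes "log_deriv_on D f \<phi>" "log_deriv_on D g \<psi>"
  shows "log_deriv_on D (\<lambda>t. f t * g t) (\<lambda>t. \<phi> t + \<psi> t)"
  using assms unfolding log_deriv_on_def
  by (auto intro!: derivative_eq_intros simp: algebra_simps)

lemma log_deriv_on_power:
  assumes "log_deriv_on D f \<phi>"
  shows "log_deriv_on D (\<lambda>t. f t ^ n) (\<lambda>t. of_nat n * \<phi> t)"
proof (induction n)
  case 0
  then show ?case by (simp add: log_deriv_on_def)
next
  case (Suc n)
  show ?case using log_deriv_on_mult[OF assms Suc] by (simp add: algebra_simps)
qed

lemma log_deriv_on_prod: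
  assumes "finite A" "\<And>j. j \<in> A \<Longrightarrow> log_deriv_on D (f j) (\<phi> j)"
  shows "log_deriv_on D (\<lambda>t. \<Prod>j\<in>A. f j t) (\<lambda>t. \<Sum>j\<in>A. \<phi> j t)"
  using assms
proof (induction A)
  case empty
  then show ?case by (simp add: log_deriv_on_def)
next
  case (insert j A)
  then show ?case using log_deriv_on_mult[of D "f j" "\<phi> j"] by simp
qed

text \<open>
  The zero set of \<open>g\<close> is closed in \<open>D\<close>. It is also open: near a zero \<open>p\<close>, with \<open>\<bar>\<phi>\<bar> \<le> M\<close>, the mean
  value inequality on a convex neighbourhood of radius at most \<open>1 / (2 M)\<close> halves any bound for \<open>\<bar>g\<bar>\<close>.
\<close>

lemma log_deriv_on_eq_0:
  assumes D: "connected D" "\<And>p. p \<in> D \<Longrightarrow> \<exists>r>0. convex (D \<inter> ball p r)"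
    and g: "log_deriv_on D g \<phi>" and \<phi>: "continuous_on D \<phi>"
    and t0: "t0 \<in> D" "g t0 = 0" and t: "t \<in> D"
  shows "g t = 0"
proof -
  let ?Z = "{t \<in> D. g t = 0}"
  have der: "(g has_field_derivative \<phi> s * g s) (at s within D)" if "s \<in> D" for s
    using g that by (auto simp: log_deriv_on_def)
  have cont: "continuous_on D g"
    using der by (meson DERIV_continuous continuous_on_eq_continuous_within)
  have "closedin (top_of_set D) ?Z"
    using cont by (rule continuous_closedin_preimage_constant)
  moreover have "openin (top_of_set D) ?Z"
  proof (subst openin_euclidean_subtopology_iff, intro conjI ballI)
    fix p assume "p \<in> ?Z"
    then have p: "p \<in> D" "g p = 0" by auto
    define M where "M = norm (\<phi> p) + 1"
    have "M > 0" by (simp add: M_def add_nonneg_pos)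
    obtain r0 where r0: "r0 > 0" "convex (D \<inter> ball p r0)" using D(2) p(1) by blast
    obtain r1 where r1: "r1 > 0" "\<And>s. s \<in> D \<Longrightarrow> dist s p < r1 \<Longrightarrow> dist (\<phi> s) (\<phi> p) < 1"
      using \<phi> p(1) unfolding continuous_on_iff by (metis zero_less_one)
    obtain r2 where r2: "r2 > 0" "\<And>s. s \<in> D \<Longrightarrow> dist s p < r2 \<Longrightarrow> dist (g s) (g p) < 1"
      using cont p(1) unfolding continuous_on_iff by (metis zero_less_one)
    define r where "r = Min {r0, r1, r2, 1 / (2 * M)}"
    have r: "r > 0" "r \<le> r0" "r \<le> r1" "r \<le> r2" "r \<le> 1 / (2 * M)"
      using r0 r1 r2 \<open>M > 0\<close> by (auto simp: r_def)
    define S where "S = D \<inter> ball p r"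
    have "S = (D \<inter> ball p r0) \<inter> ball p r" using r by (auto simp: S_def)
    then have "convex S" using r0 by (simp add: convex_Int)
    have pS: "p \<in> S" using p r by (simp add: S_def)
    have M: "norm (\<phi> s) \<le> M" if "s \<in> S" for s
    proof -
      have "dist (\<phi> s) (\<phi> p) < 1"
        using that r by (intro r1(2)) (auto simp: S_def dist_commute)
      then show ?thesis
        using norm_triangle_ineq2[of "\<phi> s" "\<phi> p"] by (simp add: M_def dist_norm)
    qed
    have bound: "norm (g s) \<le> (1 / 2) ^ n" if "s \<in> S" for n s
      using that
    proof (induction n arbitrary: s)
      case 0
      have "dist (g s) (g p) < 1"
        using 0 r by (intro r2(2)) (auto simp: S_def dist_commute)
      then show ?case using p by simp
    next
      case (Suc n)
      have "norm (g s - g p) \<le> (M * (1 / 2) ^ n) * norm (s - p)"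
      proof (rule field_differentiable_bound[OF \<open>convex S\<close>])
        show "(g has_field_derivative \<phi> z * g z) (at z within S)" if "z \<in> S" for z
          using der[of z] that by (auto simp: S_def intro: DERIV_subset)
        show "norm (\<phi> z * g z) \<le> M * (1 / 2) ^ n" if "z \<in> S" for z
          unfolding norm_mult using M[OF that] Suc.IH[OF that] \<open>M > 0\<close>
          by (intro mult_mono) auto
      qed (use Suc pS in auto)
      also have "norm (s - p) \<le> 1 / (2 * M)"
        using Suc.prems r by (auto simp: S_def dist_norm norm_minus_commute)
      then have "(M * (1 / 2) ^ n) * norm (s - p) \<le> (M * (1 / 2) ^ n) * (1 / (2 * M))"
        using \<open>M > 0\<close> by (intro mult_left_mono) auto
      also have "\<dots> = (1 / 2) ^ Suc n" using \<open>M > 0\<close> by simp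
      finally show ?case using p by simp
    qed
    have "g s = 0" if "s \<in> S" for s
    proof -
      have "(\<lambda>n. (1 / 2 :: real) ^ n) \<longlonglongrightarrow> 0" by (rule LIMSEQ_realpow_zero) auto
      then have "norm (g s) \<le> 0"
        by (rule LIMSEQ_le_const) (use bound[OF that] in auto)
      then show ?thesis by simp
    qed
    then show "\<exists>e>0. \<forall>s\<in>D. dist s p < e \<longrightarrow> s \<in> ?Z"
      using r(1) by (intro exI[of _ r]) (auto simp: S_def dist_commute)
  qed auto
  ultimately have "?Z = {} \<or> ?Z = D" using D(1) unfolding connected_clopen by blast
  then show ?thesis using t0 t by blast
qed

lemma log_deriv_on_unique:
  assumes D: "connected D" "\<And>p. p \<in> D \<Longrightarrow> \<exists>r>0. convex (D \<inter> ball p r)"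
    and f: "log_deriv_on D f \<phi>" and g: "log_deriv_on D g \<phi>" and \<phi>: "continuous_on D \<phi>"
    and t0: "t0 \<in> D" "f t0 = C * g t0" and t: "t \<in> D"
  shows "f t = C * g t"
proof -
  have "log_deriv_on D (\<lambda>t. f t - C * g t) \<phi>"
    using f g unfolding log_deriv_on_def
    by (auto intro!: derivative_eq_intros simp: algebra_simps)
  then have "f t - C * g t = 0"
    using log_deriv_on_eq_0[where g = "\<lambda>t. f t - C * g t", OF D _ \<phi> t0(1) _ t] t0(2) by simp
  then show ?thesis by simp
qed

lemma time_domain_connected_locally_convex:
  assumes "real_time_domain D \<or> complex_time_domain D"
  shows "connected D" and "p \<in> D \<Longrightarrow> \<exists>r>0. convex (D \<inter> ball p r)" and "0 \<in> D"
proof -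
  have "connected D \<and> (p \<in> D \<longrightarrow> (\<exists>r>0. convex (D \<inter> ball p r))) \<and> 0 \<in> D"
    using assms
  proof
    assume "real_time_domain D"
    then obtain I :: "real set" where I: "is_interval I" "0 \<in> I" "D = of_real ` I"
      by (auto simp: real_time_domain_def)
    have "convex D"
      unfolding I(3) using I(1)
      by (intro convex_linear_image) (auto simp: is_interval_convex bounded_linear.linear bounded_linear_of_real)
    then show ?thesis
      using I by (auto intro: convex_connected convex_Int exI[of _ 1] simp: image_iff)
  next
    assume "complex_time_domain D"
    moreover from this have "\<exists>r>0. convex (D \<inter> ball p r)" if "p \<in> D"
      using that by (metis Int_absorb1 complex_time_domain_def convex_ball openE)
    ultimately show ?thesis by (auto simp: complex_time_domain_def)
  qed
  then show "connected D" "p \<in> D \<Longrightarrow> \<exists>r>0. convex (D \<inter> ball p r)" "0 \<in> D" by auto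
qed

section \<open>The first integral\<close>

text \<open>
  The integers \<open>N f(j)\<close> are split into positive and negative parts, because they become
  exponents on the two sides of a polynomial relation.
\<close>

lemma Rats_common_denominator:
  fixes f :: "'b \<Rightarrow> 'a::field_char_0"
  assumes "finite A" "\<And>j. j \<in> A \<Longrightarrow> f j \<in> \<rat>"
  obtains N :: nat and p m :: "'b \<Rightarrow> nat" where "N > 0"
    "\<And>j. j \<in> A \<Longrightarrow> of_nat (p j) - of_nat (m j) = of_nat N * f j"
proof -
  have "\<exists>N>0. \<forall>j\<in>A. of_nat N * f j \<in> \<int>"
    using assms
  proof (induction A)
    case empty
    then show ?case by auto
  next
    case (insert i A)
    then obtain N where N: "N > 0" "\<forall>j\<in>A. of_nat N * f j \<in> \<int>" by auto
    obtain k n where n: "n > 0" "f i = of_int k / of_int n"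
      using insert.prems by (metis Rats_cases' insertI1)
    have n': "of_nat (nat n) = (of_int n :: 'a)" "of_int n * f i = of_int k"
      using n by simp_all
    have "of_nat (N * nat n) * f j \<in> \<int>" if "j \<in> insert i A" for j
    proof (cases "j = i")
      case True
      then have "of_nat (N * nat n) * f j = of_nat N * of_int k"
        by (simp only: of_nat_mult n' mult.assoc)
      then show ?thesis by (simp only: Ints_mult Ints_of_nat Ints_of_int)
    next
      case False
      then have "of_nat (N * nat n) * f j = of_int n * (of_nat N * f j)"
        by (simp only: of_nat_mult n' mult_ac)
      moreover have "of_nat N * f j \<in> \<int>" using N(2) False that by simp
      ultimately show ?thesis by (simp only: Ints_mult Ints_of_int)
    qed
    then show ?case using N(1) n(1) by (intro exI[of _ "N * nat n"]) auto
  qed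
  then obtain N where N: "N > 0" "\<forall>j\<in>A. \<exists>k. of_nat N * f j = of_int k"
    unfolding Ints_def by (auto simp: image_iff)
  then obtain k where k: "\<forall>j\<in>A. of_nat N * f j = of_int (k j)" by metis
  have split: "of_nat (nat i) - of_nat (nat (- i)) = (of_int i :: 'a)" for i
    by (cases "i \<ge> 0") auto
  show ?thesis
    by (rule that[of N "\<lambda>j. nat (k j)" "\<lambda>j. nat (- k j)"]) (use N k split in auto)
qed

text \<open>Lagrange interpolation of the constant \<open>1\<close> at the nodes \<open>u\<^sub>1, u\<^sub>2, u\<^sub>3\<close>.\<close>

lemma lagrange_sum_eq_1:
  fixes u :: "nat \<Rightarrow> complex"
  assumes "inj_on u {1, 2, 3}"
  shows "(\<Sum>j\<in>{1, 2, 3}. lam u j * (\<Prod>l\<in>{1, 2, 3} - {j}. z - u l)) = 1"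
proof -
  have d: "u 1 - u 2 \<noteq> 0" "u 1 - u 3 \<noteq> 0" "u 2 - u 3 \<noteq> 0"
    using assms by (auto simp: inj_on_def)
  have s: "{1, 2, 3} - {1 :: nat} = {2, 3}" "{1, 2, 3} - {2 :: nat} = {1, 3}"
    "{1, 2, 3} - {3 :: nat} = {1, 2}" by auto
  have d': "u 2 - u 1 \<noteq> 0" "u 3 - u 1 \<noteq> 0" "u 3 - u 2 \<noteq> 0"
    using assms by (auto simp: inj_on_def)
  have l: "lam u 1 = 1 / ((u 1 - u 2) * (u 1 - u 3))"
    "lam u 2 = 1 / ((u 2 - u 1) * (u 2 - u 3))" "lam u 3 = 1 / ((u 3 - u 1) * (u 3 - u 2))"
    using assms unfolding lam_def s by (simp_all add: inverse_eq_divide inj_on_def)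
  have "(z - u 2) * (z - u 3) / ((u 1 - u 2) * (u 1 - u 3))
      + (z - u 1) * (z - u 3) / ((u 2 - u 1) * (u 2 - u 3))
      + (z - u 1) * (z - u 2) / ((u 3 - u 1) * (u 3 - u 2)) = 1"
    using d d' by (simp add: divide_simps del: right_minus_eq) algebra
  then show ?thesis
    using assms by (simp add: s l inj_on_def add.assoc del: One_nat_def)
qed

lemma monic_cubic_factorization:
  fixes u :: "nat \<Rightarrow> complex"
  assumes roots: "{z. z ^ 3 + \<alpha> * z ^ 2 + \<beta> * z + \<delta> = 0} = {u 1, u 2, u 3}"
    and inj: "inj_on u {1, 2, 3}"
  shows "z ^ 3 + \<alpha> * z ^ 2 + \<beta> * z + \<delta> = (\<Prod>j\<in>{1, 2, 3}. z - u j)"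
proof -
  have d: "u 1 \<noteq> u 2" "u 1 \<noteq> u 3" "u 2 \<noteq> u 3"
    using inj by (auto simp: inj_on_def)
  have r: "u j ^ 3 + \<alpha> * u j ^ 2 + \<beta> * u j + \<delta> = 0" if "j \<in> {1, 2, 3}" for j
    using roots that by auto
  let ?q = "[:\<delta>, \<beta>, \<alpha>, 1:] - (\<Prod>j\<in>{1, 2, 3}. [:- u j, 1:])"
  \<comment> \<open>a polynomial of degree at most \<open>2\<close> with three zeros\<close>
  have "?q = 0"
  proof (rule ccontr)
    assume "?q \<noteq> 0"
    have q: "?q = [:\<delta> + u 1 * u 2 * u 3, \<beta> - u 1 * u 2 - u 1 * u 3 - u 2 * u 3, \<alpha> + u 1 + u 2 + u 3:]"
      by (simp add: algebra_simps)
    have "card {u 1, u 2, u 3} \<le> card {x. poly ?q x = 0}"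
    proof (rule card_mono)
      show "finite {x. poly ?q x = 0}" using \<open>?q \<noteq> 0\<close> by (rule poly_roots_finite)
      show "{u 1, u 2, u 3} \<subseteq> {x. poly ?q x = 0}"
        using r[of 1] r[of 2] r[of 3] by (auto simp: poly_prod power3_eq_cube power2_eq_square algebra_simps)
    qed
    also have "\<dots> \<le> degree ?q" by (rule card_poly_roots_bound[OF \<open>?q \<noteq> 0\<close>])
    also have "\<dots> \<le> 2" unfolding q by simp
    finally show False using d by simp
  qed
  then have "poly ?q z = 0" by (simp only: poly_0)
  moreover have "poly ?q z = z ^ 3 + \<alpha> * z ^ 2 + \<beta> * z + \<delta> - (\<Prod>j\<in>{1, 2, 3}. z - u j)"
    unfolding poly_diff poly_prod by (simp add: power3_eq_cube power2_eq_square algebra_simps)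
  ultimately show ?thesis by (simp only: right_minus_eq)
qed

text \<open>
  The relation is a nontrivial polynomial one: at a zero \<open>s\<close> of \<open>\<tau>\<close> its left side vanishes, while
  its right side is nonzero at any \<open>z\<close> that is none of the \<open>e j\<close>.
\<close>

lemma algebraic_function_on_first_integral:
  assumes "finite A" "C \<noteq> 0" "N > 0" "poly \<tau> s = 0"
    and rel: "\<And>t. t \<in> D \<Longrightarrow>
      poly \<tau> t ^ N * (\<Prod>j\<in>A. (f t - e j) ^ p j) = C * (\<Prod>j\<in>A. (f t - e j) ^ m j)"
  shows "algebraic_function_on D f"
proof -
  define P where "P = [:\<tau>:] ^ N * (\<Prod>j\<in>A. [:[:- e j:], 1:] ^ p j)
    - [:[:C:]:] * (\<Prod>j\<in>A. [:[:- e j:], 1:] ^ m j)"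
  have P: "poly (poly P [:z:]) t = poly \<tau> t ^ N * (\<Prod>j\<in>A. (z - e j) ^ p j)
      - C * (\<Prod>j\<in>A. (z - e j) ^ m j)" for z t
    by (simp add: P_def poly_prod)
  obtain z where "z \<notin> e ` A"
    using ex_new_if_finite[OF infinite_UNIV_char_0] assms(1) by blast
  then have "(\<Prod>j\<in>A. (z - e j) ^ m j) \<noteq> 0"
    using assms(1) by auto
  then have "poly (poly P [:z:]) s \<noteq> 0"
    using assms(2-4) by (simp add: P power_0_left)
  then have "P \<noteq> 0" by auto
  then show ?thesis
    unfolding algebraic_function_on_def using rel by (intro exI[of _ P]) (auto simp: P)
qed

section \<open>Algebraicity of the solutions\<close>

text \<open>
  The coefficients come from Cramer's rule: the columns \<open>(c\<^sub>1\<^sub>l, c\<^sub>2\<^sub>l)\<close> solve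
  \<open>a\<^sub>1 c\<^sub>1 + a\<^sub>2 c\<^sub>2 = r\<close>, \<open>b\<^sub>1 c\<^sub>1 + b\<^sub>2 c\<^sub>2 = k\<close>, where \<open>r\<close> and \<open>k\<close> run through the coefficients of the
  expansions of \<open>y^3\<close> and of the cubic form for \<open>w\<close>.
\<close>

lemma system_in_yw:
  assumes "cdet a b \<noteq> 0"
  shows "a 1 * (c11 a b \<gamma> * p ^ 3 + c12 a b \<gamma> * p ^ 2 * q + c13 a b \<gamma> * p * q ^ 2 + c14 a b \<gamma> * q ^ 3)
       + a 2 * (c21 a b \<gamma> * p ^ 3 + c22 a b \<gamma> * p ^ 2 * q + c23 a b \<gamma> * p * q ^ 2 + c24 a b \<gamma> * q ^ 3)
       = (a 1 * p + a 2 * q) ^ 3" (is ?y)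
    and "b 1 * (c11 a b \<gamma> * p ^ 3 + c12 a b \<gamma> * p ^ 2 * q + c13 a b \<gamma> * p * q ^ 2 + c14 a b \<gamma> * q ^ 3)
       + b 2 * (c21 a b \<gamma> * p ^ 3 + c22 a b \<gamma> * p ^ 2 * q + c23 a b \<gamma> * p * q ^ 2 + c24 a b \<gamma> * q ^ 3)
       = (b 1 * p + b 2 * q) ^ 3 + \<gamma> 1 * (a 1 * p + a 2 * q) * (b 1 * p + b 2 * q) ^ 2
         + \<gamma> 2 * (a 1 * p + a 2 * q) ^ 2 * (b 1 * p + b 2 * q) + \<gamma> 3 * (a 1 * p + a 2 * q) ^ 3" (is ?w)
proof -
  have y: "a 1 * ((r * b 2 - a 2 * k) / cdet a b) + a 2 * ((- (r * b 1) + a 1 * k) / cdet a b) = r"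
    and w: "b 1 * ((r * b 2 - a 2 * k) / cdet a b) + b 2 * ((- (r * b 1) + a 1 * k) / cdet a b) = k"
    for r k
    using assms by (simp_all add: field_simps) (simp_all add: cdet_def algebra_simps)
  note c = c11_def c12_def c13_def c14_def c21_def c22_def c23_def c24_def
  have y': "a 1 * c11 a b \<gamma> + a 2 * c21 a b \<gamma> = a 1 ^ 3"
    "a 1 * c12 a b \<gamma> + a 2 * c22 a b \<gamma> = 3 * a 1 ^ 2 * a 2"
    "a 1 * c13 a b \<gamma> + a 2 * c23 a b \<gamma> = 3 * a 1 * a 2 ^ 2"
    "a 1 * c14 a b \<gamma> + a 2 * c24 a b \<gamma> = a 2 ^ 3"
    unfolding c by (rule y)+
  have w': "b 1 * c11 a b \<gamma> + b 2 * c21 a b \<gamma> = K1 a b \<gamma>"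
    "b 1 * c12 a b \<gamma> + b 2 * c22 a b \<gamma> = K2 a b \<gamma>"
    "b 1 * c13 a b \<gamma> + b 2 * c23 a b \<gamma> = K3 a b \<gamma>"
    "b 1 * c14 a b \<gamma> + b 2 * c24 a b \<gamma> = K4 a b \<gamma>"
    unfolding c by (rule w)+
  have collect: "i * (k1 * p ^ 3 + k2 * p ^ 2 * q + k3 * p * q ^ 2 + k4 * q ^ 3)
      + j * (l1 * p ^ 3 + l2 * p ^ 2 * q + l3 * p * q ^ 2 + l4 * q ^ 3)
      = (i * k1 + j * l1) * p ^ 3 + (i * k2 + j * l2) * p ^ 2 * q
        + (i * k3 + j * l3) * p * q ^ 2 + (i * k4 + j * l4) * q ^ 3"
    for i j k1 k2 k3 k4 l1 l2 l3 l4 :: complex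
    by (simp add: algebra_simps)
  show ?y unfolding collect y' by algebra
  show ?w unfolding collect w' K1_def K2_def K3_def K4_def by algebra
qed

theorem mainTheorem2:
  fixes a b \<gamma> u :: "nat \<Rightarrow> complex"
    and D :: "complex set"
    and x :: "nat \<Rightarrow> complex \<Rightarrow> complex"
    and y w :: "complex \<Rightarrow> complex"
  assumes "cdet a b \<noteq> 0"
    and "{z. z ^ 3 + \<gamma> 1 * z ^ 2 + (\<gamma> 2 - 1) * z + \<gamma> 3 = 0} = {u 1, u 2, u 3}"
    and "inj_on u {1, 2, 3}"
    and "\<forall>j\<in>{1, 2, 3}. lam u j \<in> \<rat>"
    and "real_time_domain D \<or> complex_time_domain D"
    and "\<forall>t\<in>D. (x 1 has_field_derivative
           c11 a b \<gamma> * x 1 t ^ 3 + c12 a b \<gamma> * x 1 t ^ 2 * x 2 t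
           + c13 a b \<gamma> * x 1 t * x 2 t ^ 2 + c14 a b \<gamma> * x 2 t ^ 3) (at t within D)"
    and "\<forall>t\<in>D. (x 2 has_field_derivative
           c21 a b \<gamma> * x 1 t ^ 3 + c22 a b \<gamma> * x 1 t ^ 2 * x 2 t
           + c23 a b \<gamma> * x 1 t * x 2 t ^ 2 + c24 a b \<gamma> * x 2 t ^ 3) (at t within D)"
    and "\<forall>t. y t = a 1 * x 1 t + a 2 * x 2 t"
    and "\<forall>t. w t = b 1 * x 1 t + b 2 * x 2 t"
    and "y 0 \<noteq> 0"
    and "w 0 / y 0 \<notin> {u 1, u 2, u 3}"
  shows "algebraic_function_on D (\<lambda>t. w t / y t)
    \<and> algebraic_function_on D (x 1) \<and> algebraic_function_on D (x 2)"
proof -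
  note D = time_domain_connected_locally_convex(1,2)[OF assms(5)] and D0 = time_domain_connected_locally_convex(3)[OF assms(5)]
  define f where "f t = w t / y t" for t
  let ?J = "{1, 2, 3 :: nat}"

  have y_eq: "y = (\<lambda>t. a 1 * x 1 t + a 2 * x 2 t)" and w_eq: "w = (\<lambda>t. b 1 * x 1 t + b 2 * x 2 t)"
    using assms(8,9) by auto
  have dy: "(y has_field_derivative y t ^ 3) (at t within D)" if "t \<in> D" for t
    using DERIV_add[OF DERIV_cmult[OF bspec[OF assms(6) that], of "a 1"]
        DERIV_cmult[OF bspec[OF assms(7) that], of "a 2"]]
    unfolding system_in_yw(1)[OF assms(1)] by (simp add: y_eq)
  have dw: "(w has_field_derivative
      w t ^ 3 + \<gamma> 1 * y t * w t ^ 2 + \<gamma> 2 * y t ^ 2 * w t + \<gamma> 3 * y t ^ 3) (at t within D)"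
    if "t \<in> D" for t
    using DERIV_add[OF DERIV_cmult[OF bspec[OF assms(6) that], of "b 1"]
        DERIV_cmult[OF bspec[OF assms(7) that], of "b 2"]]
    unfolding system_in_yw(2)[OF assms(1)] by (simp add: y_eq w_eq)
  have cont_y: "continuous_on D y"
    using dy by (meson DERIV_continuous continuous_on_eq_continuous_within)

  define \<tau> where "\<tau> = [:1, - 2 * y 0 ^ 2:]"
  have \<tau>: "poly \<tau> t = 1 - 2 * y 0 ^ 2 * t" for t by (simp add: \<tau>_def)
  \<comment> \<open>The defect \<open>y^2 \<tau> - y(0)^2\<close> satisfies a linear homogeneous equation. This avoids dividing by
    \<open>y\<close> or \<open>\<tau>\<close> and shows that neither vanishes on \<open>D\<close>.\<close>
  have y\<tau>: "y t ^ 2 * poly \<tau> t = y 0 ^ 2" if "t \<in> D" for t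
  proof -
    have ld: "log_deriv_on D (\<lambda>t. y t ^ 2 * poly \<tau> t - y 0 ^ 2) (\<lambda>t. 2 * y t ^ 2)"
      unfolding log_deriv_on_def \<tau>
      by (auto intro!: derivative_eq_intros dy simp: algebra_simps power2_eq_square power3_eq_cube)
    have "y t ^ 2 * poly \<tau> t - y 0 ^ 2 = 0"
      using log_deriv_on_eq_0[OF D ld _ D0 _ that]
      by (simp add: \<tau> continuous_intros cont_y)
    then show ?thesis by simp
  qed
  then have y_nz: "y t \<noteq> 0" if "t \<in> D" for t
    using that assms(10) by fastforce

  have df: "(f has_field_derivative y t ^ 2 * (\<Prod>j\<in>?J. f t - u j)) (at t within D)"
    if "t \<in> D" for t
  proof -
    have "(f has_field_derivative
        ((w t ^ 3 + \<gamma> 1 * y t * w t ^ 2 + \<gamma> 2 * y t ^ 2 * w t + \<gamma> 3 * y t ^ 3) * y t - w t * y t ^ 3)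
          / (y t * y t)) (at t within D)"
      unfolding f_def by (rule DERIV_divide[OF dw[OF that] dy[OF that] y_nz[OF that]])
    moreover have "((w t ^ 3 + \<gamma> 1 * y t * w t ^ 2 + \<gamma> 2 * y t ^ 2 * w t + \<gamma> 3 * y t ^ 3) * y t
        - w t * y t ^ 3) / (y t * y t)
      = y t ^ 2 * (f t ^ 3 + \<gamma> 1 * f t ^ 2 + (\<gamma> 2 - 1) * f t + \<gamma> 3)"
      using y_nz[OF that] by (simp add: f_def field_simps power2_eq_square power3_eq_cube)
    ultimately show ?thesis
      by (simp only: monic_cubic_factorization[OF assms(2,3)])
  qed
  have cont_f: "continuous_on D f"
    using df by (meson DERIV_continuous continuous_on_eq_continuous_within)

  define \<phi> where "\<phi> j t = y t ^ 2 * (\<Prod>l\<in>?J - {j}. f t - u l)" for j t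
  have ld: "log_deriv_on D (\<lambda>t. f t - u j) (\<phi> j)" if "j \<in> ?J" for j
  proof -
    have "(\<Prod>l\<in>?J. f t - u l) = (f t - u j) * (\<Prod>l\<in>?J - {j}. f t - u l)" for t
      using that by (intro prod.remove) auto
    then show ?thesis
      unfolding log_deriv_on_def
      by (auto intro!: derivative_eq_intros df simp: \<phi>_def)
  qed
  have ld\<tau>: "log_deriv_on D (poly \<tau>) (\<lambda>t. - 2 * y t ^ 2)"
    unfolding log_deriv_on_def
  proof
    fix t assume "t \<in> D"
    have "(poly \<tau> has_field_derivative - 2 * y 0 ^ 2) (at t within D)"
      unfolding \<tau>_def by (auto intro!: derivative_eq_intros simp: pderiv_pCons)
    then show "(poly \<tau> has_field_derivative - 2 * y t ^ 2 * poly \<tau> t) (at t within D)"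
      using y\<tau>[OF \<open>t \<in> D\<close>] by (simp add: mult.assoc)
  qed

  \<comment> \<open>The factor \<open>2\<close> is there because \<open>\<tau>\<close>, a multiple of \<open>1 / y^2\<close>, enters instead of \<open>y\<close>.\<close>
  obtain N :: nat and p m :: "nat \<Rightarrow> nat" where N: "N > 0"
    "\<And>j. j \<in> ?J \<Longrightarrow> of_nat (p j) - of_nat (m j) = of_nat N * (2 * lam u j)"
  proof (rule Rats_common_denominator)
    show "2 * lam u j \<in> \<rat>" if "j \<in> ?J" for j
      using assms(4) that by (intro Rats_mult) auto
  qed auto
  define A where "A t = (\<Prod>j\<in>?J. (f t - u j) ^ p j)" for t
  define B where "B t = (\<Prod>j\<in>?J. (f t - u j) ^ m j)" for t
  have ldA: "log_deriv_on D A (\<lambda>t. \<Sum>j\<in>?J. of_nat (p j) * \<phi> j t)"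
    unfolding A_def by (intro log_deriv_on_prod log_deriv_on_power ld) auto
  have ldB: "log_deriv_on D B (\<lambda>t. \<Sum>j\<in>?J. of_nat (m j) * \<phi> j t)"
    unfolding B_def by (intro log_deriv_on_prod log_deriv_on_power ld) auto
  have exponents: "of_nat N * (- 2 * y t ^ 2) + (\<Sum>j\<in>?J. of_nat (p j) * \<phi> j t)
      = (\<Sum>j\<in>?J. of_nat (m j) * \<phi> j t)" for t
  proof -
    have "(\<Sum>j\<in>?J. of_nat (p j) * \<phi> j t) - (\<Sum>j\<in>?J. of_nat (m j) * \<phi> j t)
        = (\<Sum>j\<in>?J. (of_nat (p j) - of_nat (m j)) * \<phi> j t)"
      by (simp only: left_diff_distrib sum_subtractf)
    also have "\<dots> = (\<Sum>j\<in>?J. (of_nat N * 2 * y t ^ 2) * (lam u j * (\<Prod>l\<in>?J - {j}. f t - u l)))"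
      using N(2) by (intro sum.cong) (simp_all only: \<phi>_def mult_ac)
    also have "\<dots> = of_nat N * 2 * y t ^ 2"
      by (simp only: sum_distrib_left[symmetric] lagrange_sum_eq_1[OF assms(3)] mult_1_right)
    finally show ?thesis by (simp add: algebra_simps del: sum.insert)
  qed
  have AB0: "A 0 \<noteq> 0" "B 0 \<noteq> 0"
    using assms(11) by (auto simp: A_def B_def f_def)
  \<comment> \<open>Since \<open>\<tau>(0) = 1\<close>, this is the value of the conserved quotient at time \<open>0\<close>.\<close>
  define C where "C = A 0 / B 0"
  have rel: "poly \<tau> t ^ N * A t = C * B t" if "t \<in> D" for t
  proof (rule log_deriv_on_unique[OF D _ ldB])
    show "log_deriv_on D (\<lambda>t. poly \<tau> t ^ N * A t) (\<lambda>t. \<Sum>j\<in>?J. of_nat (m j) * \<phi> j t)"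
      using log_deriv_on_mult[OF log_deriv_on_power[OF ld\<tau>, of N] ldA]
      unfolding exponents .
    show "continuous_on D (\<lambda>t. \<Sum>j\<in>?J. of_nat (m j) * \<phi> j t)"
      unfolding \<phi>_def by (intro continuous_intros cont_y cont_f)
    show "poly \<tau> 0 ^ N * A 0 = C * B 0"
      using AB0 by (simp add: \<tau> C_def)
  qed (use D0 that in auto)

  have f_alg: "algebraic_function_on D f"
  proof (rule algebraic_function_on_first_integral)
    show "poly \<tau> (1 / (2 * y 0 ^ 2)) = 0" "C \<noteq> 0"
      using assms(10) AB0 by (auto simp: \<tau>_def C_def)
    show "poly \<tau> t ^ N * (\<Prod>j\<in>?J. (f t - u j) ^ p j) = C * (\<Prod>j\<in>?J. (f t - u j) ^ m j)"
      if "t \<in> D" for t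
      using rel[OF that] by (simp only: A_def B_def)
  qed (use N in auto)

  have y_times: "algebraic_function_on D (\<lambda>t. y t * (\<alpha> + \<beta> * f t))" for \<alpha> \<beta>
    by (rule algebraic_function_on_mult_sqrt[OF algebraic_function_on_affine[OF f_alg], of \<tau> "y 0 ^ 2"])
       (use y\<tau> assms(10) in \<open>auto simp: \<tau>_def\<close>)
  have x_eq: "x 1 t = y t * (b 2 / cdet a b + - a 2 / cdet a b * f t)"
    "x 2 t = y t * (- b 1 / cdet a b + a 1 / cdet a b * f t)" if "t \<in> D" for t
  proof -
    have "y t * f t = w t" using y_nz[OF that] by (simp add: f_def)
    then have lin: "y t * (\<alpha> / cdet a b + \<beta> / cdet a b * f t) = (\<alpha> * y t + \<beta> * w t) / cdet a b" for \<alpha> \<beta>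
      by (simp add: add_divide_distrib algebra_simps)
    have "x 1 t * cdet a b = b 2 * y t + - a 2 * w t" "x 2 t * cdet a b = - b 1 * y t + a 1 * w t"
      by (simp_all add: y_eq w_eq cdet_def algebra_simps)
    then show "x 1 t = y t * (b 2 / cdet a b + - a 2 / cdet a b * f t)"
      "x 2 t = y t * (- b 1 / cdet a b + a 1 / cdet a b * f t)"
      unfolding lin using assms(1) by (simp_all add: eq_divide_eq)
  qed
  have "algebraic_function_on D (x 1)" "algebraic_function_on D (x 2)"
    using y_times[of "b 2 / cdet a b" "- a 2 / cdet a b"]
      y_times[of "- b 1 / cdet a b" "a 1 / cdet a b"] x_eq
    by (auto simp: algebraic_function_on_def)
  then show ?thesis using f_alg unfolding f_def by blast
qed

end
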